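(* Let $X, W$ be Banach spaces and let $T\in L(X,W)$. Suppose that for some $C\ge 1$ there exists a sequence $(S_N)_{N=1}^\infty$ of finite rank operators from $X$ to $W$ such that $S_Nx\to Tx$ as $N\to+\infty$ for every $x\in X$, and $\|S_N\|\le C\|T\|$ for every $N$. Then there exist a Banach space $Y$ with a Schauder basis and two operators $\widetilde A\in L(X,Y)$ and $j\in L(Y,W)$ such that $T=j\widetilde A$.
   Context: $L(X,W)$ denotes the space of bounded linear operators from $X$ to $W$ with the operator norm. Finite rank operators are bounded linear operators with finite-dimensional range. *)

theory Defs
  imports "HOL-Analysis.Analysis" "HOL-Library.Function_Algebras"
begin

text \<open>
  The class \<open>banach\<close> only knows real scalars.  To cover real and complex Banach spaces at once,
  the scalar field is a type \<open>'k :: {real_normed_field, banach}\<close>: a complete normed field over the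
  reals with multiplicative norm, i.e. (Gelfand-Mazur) the reals or the complex numbers.

  A normed space consists of a scalar multiplication \<open>s\<close> making the additive group \<open>'v\<close> a vector
  space over \<open>'k\<close>, a linear subspace \<open>V\<close> (the points of the space), and a function \<open>nrm\<close> that is a
  norm on \<open>V\<close>; its values outside \<open>V\<close> are irrelevant.  Carriers are needed because a type cannot be
  quantified existentially.  The whole of a type of class \<open>banach\<close> is the case
  \<open>V = UNIV\<close>, \<open>nrm = norm\<close>.
\<close>

definition normed_space_on ::
    "('k::{real_normed_field,banach} \<Rightarrow> 'v \<Rightarrow> 'v::ab_group_add) \<Rightarrow> 'v set \<Rightarrow> ('v \<Rightarrow> real) \<Rightarrow> bool" where
  "normed_space_on s V nrm \<longleftrightarrow>
     vector_space s \<and> module.subspace s V \<and>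
     (\<forall>v\<in>V. nrm v \<ge> 0) \<and>
     (\<forall>v\<in>V. nrm v = 0 \<longleftrightarrow> v = 0) \<and>
     (\<forall>c. \<forall>v\<in>V. nrm (s c v) = norm c * nrm v) \<and>
     (\<forall>u\<in>V. \<forall>v\<in>V. nrm (u + v) \<le> nrm u + nrm v)"

definition banach_space_on ::
    "('k::{real_normed_field,banach} \<Rightarrow> 'v \<Rightarrow> 'v::ab_group_add) \<Rightarrow> 'v set \<Rightarrow> ('v \<Rightarrow> real) \<Rightarrow> bool" where
  "banach_space_on s V nrm \<longleftrightarrow>
     normed_space_on s V nrm \<and> Metric_space.mcomplete V (\<lambda>u v. nrm (u - v))"

lemma banach_space_on_scaleR: "banach_space_on scaleR (UNIV :: 'v::banach set) norm"
proof -
  have "vector_space (scaleR :: real \<Rightarrow> 'v \<Rightarrow> 'v)"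
    by unfold_locales (auto simp: algebra_simps)
  moreover from this have "module.subspace (scaleR :: real \<Rightarrow> 'v \<Rightarrow> 'v) UNIV"
    by (intro module.subspace_UNIV) (simp add: module_iff_vector_space)
  moreover have "Metric_space.mcomplete (UNIV :: 'v set) (\<lambda>u v. norm (u - v))"
    using complete_UNIV by (simp add: mcomplete_iff_complete flip: dist_norm)
  ultimately show ?thesis
    by (auto simp: banach_space_on_def normed_space_on_def norm_triangle_ineq)
qed

text \<open>
  Membership in \<open>L(V, W)\<close>.  Only the restriction of \<open>f\<close> to \<open>V\<close> matters.
\<close>

definition bounded_operator ::
    "('k::{real_normed_field,banach} \<Rightarrow> 'v \<Rightarrow> 'v::ab_group_add) \<Rightarrow> 'v set \<Rightarrow> ('v \<Rightarrow> real) \<Rightarrow>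
     ('k \<Rightarrow> 'w \<Rightarrow> 'w::ab_group_add) \<Rightarrow> 'w set \<Rightarrow> ('w \<Rightarrow> real) \<Rightarrow> ('v \<Rightarrow> 'w) \<Rightarrow> bool" where
  "bounded_operator s V nV t W nW f \<longleftrightarrow>
     (\<forall>v\<in>V. f v \<in> W) \<and>
     (\<forall>u\<in>V. \<forall>v\<in>V. f (u + v) = f u + f v) \<and>
     (\<forall>c. \<forall>v\<in>V. f (s c v) = t c (f v)) \<and>
     (\<exists>K. \<forall>v\<in>V. nW (f v) \<le> K * nV v)"

definition finite_rank_operator ::
    "('k::{real_normed_field,banach} \<Rightarrow> 'v \<Rightarrow> 'v::ab_group_add) \<Rightarrow> 'v set \<Rightarrow> ('v \<Rightarrow> real) \<Rightarrow>
     ('k \<Rightarrow> 'w \<Rightarrow> 'w::ab_group_add) \<Rightarrow> 'w set \<Rightarrow> ('w \<Rightarrow> real) \<Rightarrow> ('v \<Rightarrow> 'w) \<Rightarrow> bool" where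
  "finite_rank_operator s V nV t W nW f \<longleftrightarrow>
     bounded_operator s V nV t W nW f \<and> (\<exists>B. finite B \<and> f ` V = module.span t B)"

definition schauder_basis ::
    "('k::{real_normed_field,banach} \<Rightarrow> 'v \<Rightarrow> 'v::ab_group_add) \<Rightarrow> 'v set \<Rightarrow> ('v \<Rightarrow> real) \<Rightarrow>
     (nat \<Rightarrow> 'v) \<Rightarrow> bool" where
  "schauder_basis s V nrm e \<longleftrightarrow>
     (\<forall>n. e n \<in> V) \<and>
     (\<forall>v\<in>V. \<exists>!a :: nat \<Rightarrow> 'k. (\<lambda>n. nrm (v - (\<Sum>i<n. s (a i) (e i)))) \<longlonglongrightarrow> 0)"

text \<open>
  Scalar multiplication of scalar sequences; addition is the pointwise one of
  \<open>HOL-Library.Function_Algebras\<close>.  Passing to coefficients identifies every Banach space that has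
  a Schauder basis with a linear subspace of \<open>nat \<Rightarrow> 'k\<close> carrying a complete norm, so asking for a
  space of this form loses no generality.
\<close>

definition seq_scale :: "'k::times \<Rightarrow> (nat \<Rightarrow> 'k) \<Rightarrow> (nat \<Rightarrow> 'k)" where
  "seq_scale c a = (\<lambda>n. c * a n)"

end

theory Submission
  imports Defs
begin

text \<open>
  \<^bold>\<open>The idea.\<close>  The strong limit \<open>T\<close> of the finite rank operators \<open>S n\<close> is the pointwise sum of the
  finite rank differences \<open>D n = S (n + 1) - S n\<close>, with \<open>D 0 = S 1\<close>.  If \<open>T\<close> were even a pointwise sum of rank one
  operators, \<open>T x = (\<Sum>p. \<phi> p x * w p)\<close> with all \<open>w p\<close> nonzero and with partial sums bounded by
  \<open>K * norm x\<close>, the factorization would be immediate: let \<open>Y\<close> consist of the scalar sequences \<open>a\<close>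
  for which \<open>\<Sum>p. a p * w p\<close> converges in \<open>W\<close>, normed by the supremum of the norms of the partial
  sums.  This is a Banach space in which the unit sequences form a Schauder basis; \<open>A x\<close> is the
  sequence of the \<open>\<phi> p x\<close>, and \<open>j\<close> sums the series (\<open>banach_space\<close>, \<open>schauder_basis_unit_seq\<close>,
  \<open>bounded_operator_suminf\<close>, \<open>factorization\<close>).

  So everything rests on the rank one expansion (\<open>rank_one_expansion\<close>).  Since coordinates on a
  finite-dimensional space are continuous, each \<open>D n\<close> is a finite sum of rank one operators
  (\<open>finite_rank_decomposition\<close>), but the partial sums of that sum may be much larger than \<open>D n\<close>
  and need not tend to zero with \<open>n\<close>.  Pelczynski's remedy is to divide the finite sum by a large
  number \<open>r\<close> and to run through it \<open>r\<close> times.  After \<open>a\<close> complete rounds the partial sum is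
  \<open>(a / r) D n\<close>, and an incomplete round contributes an operator whose norm is as small as desired
  (\<open>finite_rank_slicing\<close>).  Concatenating these expansions for \<open>n = 0, 1, 2, \<dots>\<close> leaves the
  pointwise sum unchanged, because what an incomplete \<open>n\<close>-th block adds to the preceding complete
  ones is at most \<open>norm (D n x) + norm x / (n + 1)\<close>, and \<open>D n x\<close> tends to zero.
\<close>

section \<open>Bounded operators and normed scalings\<close>

lemma bounded_operator_UNIV_I:
  assumes "\<And>x y. f (x + y) = f x + f y" "\<And>c x. f (t c x) = s c (f x)"
    and "\<And>x. norm (f x) \<le> K * norm x"
  shows "bounded_operator t UNIV norm s UNIV norm f"
  using assms by (auto simp: bounded_operator_def)

lemma norm_le_onorm_mult:
  fixes f :: "'x::real_normed_vector \<Rightarrow> 'w::real_normed_vector"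
  assumes "bounded_operator t UNIV norm s UNIV norm f"
  shows "norm (f x) \<le> onorm f * norm x"
proof -
  obtain K where K: "\<And>x. norm (f x) \<le> K * norm x"
    using assms by (auto simp: bounded_operator_def)
  show ?thesis
  proof (cases "x = 0")
    case False
    have "norm (f y) / norm y \<le> \<bar>K\<bar>" for y
      using order_trans[OF K[of y] mult_right_mono[OF abs_ge_self norm_ge_zero]]
      by (cases "y = 0") (auto simp: field_simps)
    then have "norm (f x) / norm x \<le> onorm f"
      unfolding onorm_def by (intro cSUP_upper bdd_aboveI2) auto
    then show ?thesis
      using False by (simp add: field_simps)
  qed (use K[of 0] in simp)
qed

text \<open>
  The scaling by \<open>'k\<close> and the real scaling of the type \<open>'w\<close> are linked only through the norm, so
  continuity facts about the former cannot be inherited from the type class.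
\<close>

locale scaled_banach = vector_space s
  for s :: "'k::{real_normed_field,banach} \<Rightarrow> 'w::banach \<Rightarrow> 'w" +
  assumes norm_scale: "norm (s c v) = norm c * norm v"
begin

lemma norm_scale_diff_left: "norm (s a v - s b v) = norm (a - b) * norm v"
  by (simp add: norm_scale flip: scale_left_diff_distrib)

lemma norm_scale_diff_right: "norm (s a u - s a v) = norm a * norm (u - v)"
  by (simp add: norm_scale flip: scale_right_diff_distrib)

lemma tendsto_scale_left:
  assumes "(a \<longlongrightarrow> c) F"
  shows "((\<lambda>i. s (a i) v) \<longlongrightarrow> s c v) F"
proof -
  have "((\<lambda>i. norm (a i - c) * norm v) \<longlongrightarrow> 0) F"
    using assms by (intro tendsto_mult_left_zero tendsto_norm_zero LIM_zero)
  then show ?thesis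
    by - (rule LIM_zero_cancel[OF tendsto_norm_zero_cancel], simp add: norm_scale_diff_left)
qed

lemma tendsto_scale_right:
  assumes "(f \<longlongrightarrow> v) F"
  shows "((\<lambda>i. s c (f i)) \<longlongrightarrow> s c v) F"
proof -
  have "((\<lambda>i. norm c * norm (f i - v)) \<longlongrightarrow> 0) F"
    using assms by (intro tendsto_mult_right_zero tendsto_norm_zero LIM_zero)
  then show ?thesis
    by - (rule LIM_zero_cancel[OF tendsto_norm_zero_cancel], simp add: norm_scale_diff_right)
qed

section \<open>Continuity of coordinates on finite-dimensional subspaces\<close>

text \<open>
  Scaling \<open>u = m + c b\<close>, with \<open>m\<close> in the subspace, by \<open>1 / c\<close> shows that \<open>norm u / norm c\<close> is at
  least the distance of \<open>b\<close> from the subspace.  Thus the coefficient of \<open>b\<close> depends continuously on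
  \<open>u\<close>.
\<close>

lemma dist_subspace:
  assumes "subspace M" "closed M" "b \<notin> M"
  obtains d where "d > 0" "\<And>u c. u - s c b \<in> M \<Longrightarrow> norm c * d \<le> norm u"
proof
  have M: "M \<noteq> {}"
    using subspace_0[OF assms(1)] by auto
  show "infdist b M > 0"
    using assms M by (simp add: infdist_pos_not_in_closed)
  fix u c assume u: "u - s c b \<in> M"
  show "norm c * infdist b M \<le> norm u"
  proof (cases "c = 0")
    case False
    have "s (- inverse c) (u - s c b) \<in> M"
      using assms(1) u by (rule subspace_scale)
    then have "infdist b M \<le> norm (b - s (- inverse c) (u - s c b))"
      using infdist_le by (metis dist_norm)
    also have "b - s (- inverse c) (u - s c b) = s (inverse c) u"
      using False by (simp add: scale_right_diff_distrib)
    finally have "infdist b M \<le> norm u / norm c"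
      by (simp add: norm_scale norm_inverse divide_inverse mult.commute)
    then show ?thesis
      using False by (simp add: field_simps)
  qed simp
qed

text \<open>
  Adding a vector \<open>b\<close> to a closed subspace keeps it closed: along a convergent sequence the
  coefficients of \<open>b\<close> are Cauchy by \<open>dist_subspace\<close>, and the scalar field is complete.
\<close>

lemma closed_span_finite: "finite B \<Longrightarrow> closed (span B)"
proof (induction rule: finite_induct)
  case (insert b B)
  show ?case
  proof (cases "b \<in> span B")
    case True
    then show ?thesis using insert by (simp add: span_redundant)
  next
    case False
    obtain d where d: "d > 0" "\<And>u c. u - s c b \<in> span B \<Longrightarrow> norm c * d \<le> norm u"
      using dist_subspace[OF subspace_span insert.IH False] by blast
    show ?thesis
      unfolding closed_sequential_limits
    proof (intro allI impI)
      fix v l assume vl: "(\<forall>n. v n \<in> span (insert b B)) \<and> v \<longlonglongrightarrow> l"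
      then have "\<exists>c. \<forall>n. v n - s (c n) b \<in> span B"
        by (intro choice) (auto simp: span_breakdown_eq)
      then obtain c where c: "\<And>n. v n - s (c n) b \<in> span B"
        by blast
      have "Cauchy c"
        unfolding Cauchy_def dist_norm
      proof (intro allI impI)
        fix e :: real assume "e > 0"
        then have "e * d > 0" using d by simp
        moreover have "Cauchy v"
          using vl by (auto simp: Cauchy_convergent_iff convergent_def)
        ultimately obtain N where N: "\<And>m n. m \<ge> N \<Longrightarrow> n \<ge> N \<Longrightarrow> norm (v m - v n) < e * d"
          unfolding Cauchy_def dist_norm by blast
        have "norm (c m - c n) < e" if "m \<ge> N" "n \<ge> N" for m n
        proof -
          have "(v m - v n) - s (c m - c n) b = (v m - s (c m) b) - (v n - s (c n) b)"
            by (simp add: scale_left_diff_distrib)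
          also have "\<dots> \<in> span B"
            by (intro span_diff c)
          finally have "norm (c m - c n) * d \<le> norm (v m - v n)"
            by (rule d)
          also have "\<dots> < e * d"
            using N that by blast
          finally show ?thesis
            using d by simp
        qed
        then show "\<exists>N. \<forall>m\<ge>N. \<forall>n\<ge>N. norm (c m - c n) < e"
          by blast
      qed
      then obtain c0 where "c \<longlonglongrightarrow> c0"
        by (auto simp: Cauchy_convergent_iff convergent_def)
      then have "(\<lambda>n. v n - s (c n) b) \<longlonglongrightarrow> l - s c0 b"
        using vl by (intro tendsto_diff tendsto_scale_left) auto
      then have "l - s c0 b \<in> span B"
        by (rule closed_sequentially[OF insert.IH c])
      then show "l \<in> span (insert b B)"
        by (auto simp: span_breakdown_eq)
    qed
  qed
qed simp

text \<open>
  Induction on the spanning set.  If \<open>b\<close> is redundant, its coefficient is zero.  Otherwise the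
  coefficient \<open>c x\<close> of \<open>b\<close> in \<open>D x\<close> is unique, hence linear in \<open>x\<close>, and bounded by \<open>dist_subspace\<close>;
  so \<open>D - c b\<close> is again a bounded operator, now into the span of the remaining vectors.
\<close>

lemma finite_rank_decomposition:
  fixes t :: "'k \<Rightarrow> 'x::real_normed_vector \<Rightarrow> 'x"
  assumes "finite B" "bounded_operator t UNIV norm s UNIV norm D" "range D \<subseteq> span B"
  shows "\<exists>\<phi>. (\<forall>b\<in>B. bounded_operator t UNIV norm (*) UNIV norm (\<phi> b)) \<and>
             (\<forall>x. D x = (\<Sum>b\<in>B. s (\<phi> b x) b))"
  using assms
proof (induction arbitrary: D rule: finite_induct)
  case empty
  then show ?case by auto
next
  case (insert b B)
  show ?case
  proof (cases "b \<in> span B")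
    case True
    then obtain \<phi> where \<phi>: "\<forall>b\<in>B. bounded_operator t UNIV norm (*) UNIV norm (\<phi> b)"
        "\<forall>x. D x = (\<Sum>b\<in>B. s (\<phi> b x) b)"
      using insert.IH[OF insert.prems(1)] insert.prems(2) by (auto simp: span_redundant)
    have "(\<Sum>a\<in>B. s ((\<phi>(b := \<lambda>x. 0)) a x) a) = (\<Sum>a\<in>B. s (\<phi> a x) a)" for x
      using insert.hyps by (intro sum.cong) auto
    then show ?thesis
      using insert.hyps \<phi>
      by (intro exI[of _ "\<phi>(b := \<lambda>x. 0)"]) (auto simp: bounded_operator_def intro: exI[of _ 0])
  next
    case False
    obtain d where d: "d > 0" "\<And>u c. u - s c b \<in> span B \<Longrightarrow> norm c * d \<le> norm u"
      using dist_subspace[OF subspace_span closed_span_finite[OF insert.hyps(1)] False] by blast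
    have uniq: "c = c'" if "u - s c b \<in> span B" "u - s c' b \<in> span B" for u c c'
    proof -
      have "0 - s (c - c') b = (u - s c b) - (u - s c' b)"
        by (simp add: scale_left_diff_distrib)
      also have "\<dots> \<in> span B"
        by (intro span_diff that)
      finally have "norm (c - c') * d \<le> norm (0 :: 'w)"
        by (rule d)
      then show ?thesis
        using d by (simp add: mult_le_0_iff)
    qed
    have "\<exists>c. \<forall>x. D x - s (c x) b \<in> span B"
      using insert.prems(2) by (intro choice) (auto simp: image_subset_iff span_breakdown_eq)
    then obtain c where c: "\<And>x. D x - s (c x) b \<in> span B"
      by blast
    have D_add: "D (x + y) = D x + D y" and D_scale: "D (t r x) = s r (D x)" for x y r
      using insert.prems(1) by (auto simp: bounded_operator_def)
    obtain K where K: "\<And>x. norm (D x) \<le> K * norm x"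
      using insert.prems(1) by (auto simp: bounded_operator_def)
    have c_add: "c (x + y) = c x + c y" for x y
    proof (rule uniq[OF c])
      have "D (x + y) - s (c x + c y) b = (D x - s (c x) b) + (D y - s (c y) b)"
        by (simp add: D_add scale_left_distrib)
      then show "D (x + y) - s (c x + c y) b \<in> span B"
        by (simp only: span_add c)
    qed
    have c_scale: "c (t r x) = r * c x" for x r
    proof (rule uniq[OF c])
      have "D (t r x) - s (r * c x) b = s r (D x - s (c x) b)"
        by (simp add: D_scale scale_right_diff_distrib)
      then show "D (t r x) - s (r * c x) b \<in> span B"
        by (simp only: span_scale c)
    qed
    have c_bound: "norm (c x) \<le> K / d * norm x" for x
      using order_trans[OF d(2)[OF c] K[of x]] d(1) by (simp add: field_simps)
    have "bounded_operator t UNIV norm s UNIV norm (\<lambda>x. D x - s (c x) b)"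
      unfolding bounded_operator_def
    proof (intro conjI ballI allI exI)
      fix x
      have "norm (D x - s (c x) b) \<le> norm (D x) + norm (c x) * norm b"
        by (metis norm_scale norm_triangle_ineq4)
      also have "\<dots> \<le> K * norm x + (K / d * norm x) * norm b"
        by (intro add_mono mult_right_mono K c_bound) auto
      finally show "norm (D x - s (c x) b) \<le> (K + K / d * norm b) * norm x"
        by (simp add: algebra_simps)
    qed (auto simp: D_add D_scale c_add c_scale scale_left_distrib scale_right_diff_distrib)
    from insert.IH[OF this] c obtain \<phi> where \<phi>: "\<forall>b\<in>B. bounded_operator t UNIV norm (*) UNIV norm (\<phi> b)"
        "\<forall>x. D x - s (c x) b = (\<Sum>b\<in>B. s (\<phi> b x) b)"
      by blast
    have "(\<Sum>a\<in>B. s ((\<phi>(b := c)) a x) a) = (\<Sum>a\<in>B. s (\<phi> a x) a)" for x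
      using insert.hyps by (intro sum.cong) auto
    then have "D x = (\<Sum>a\<in>insert b B. s ((\<phi>(b := c)) a x) a)" for x
      using insert.hyps \<phi>(2) by (simp add: algebra_simps)
    moreover have "bounded_operator t UNIV norm (*) UNIV norm c"
      using c_add c_scale c_bound by (rule bounded_operator_UNIV_I)
    ultimately show ?thesis
      using \<phi>(1) by (intro exI[of _ "\<phi>(b := c)"]) auto
  qed
qed

end

section \<open>Slicing a finite rank operator into rank one operators\<close>

lemma sum_lessThan_add:
  fixes f :: "nat \<Rightarrow> 'a::comm_monoid_add"
  shows "(\<Sum>i<m + n. f i) = (\<Sum>i<m. f i) + (\<Sum>i<n. f (m + i))"
  by (induction n) (auto simp: add.assoc)

context scaled_banach
begin

text \<open>
  Pelczynski's repetition trick.  Write \<open>D\<close> as a sum of \<open>m\<close> rank one operators, and let \<open>R\<close> bound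
  the sum of their norms.  Divide them by \<open>r\<close> and repeat the list \<open>r\<close> times.  Then \<open>a\<close> complete
  rounds sum to \<open>(a / r) D\<close>, no larger than \<open>D\<close> as \<open>a \<le> r\<close>, and every incomplete round is at
  most \<open>R / r\<close> in norm, hence at most \<open>\<epsilon>\<close> for large \<open>r\<close>.  The vector \<open>w0\<close> keeps the list nonempty
  when \<open>D = 0\<close>.  The \<open>f i\<close> are kept nonzero because the coefficients of a series
  can be recovered from its partial sums only if no vector of the series vanishes.
\<close>

lemma finite_rank_slicing:
  fixes t :: "'k \<Rightarrow> 'x::real_normed_vector \<Rightarrow> 'x"
  assumes "finite B" "bounded_operator t UNIV norm s UNIV norm D" "range D \<subseteq> span B"
    and "(w0 :: 'w) \<noteq> 0" "\<epsilon> > 0"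
  obtains L :: nat and f \<phi> where "0 < L" "\<And>i. f i \<noteq> 0"
    "\<And>i. bounded_operator t UNIV norm (*) UNIV norm (\<phi> i)"
    "\<And>x. (\<Sum>i<L. s (\<phi> i x) (f i)) = D x"
    "\<And>x l. l \<le> L \<Longrightarrow> norm (\<Sum>i<l. s (\<phi> i x) (f i)) \<le> norm (D x) + \<epsilon> * norm x"
proof -
  define B' where "B' = insert w0 B - {0}"
  have B': "finite B'" "range D \<subseteq> span B'"
    using assms(1,3) span_mono[of B "insert w0 B"] by (auto simp: B'_def)
  have "w0 \<in> B'" using assms(4) by (simp add: B'_def)
  define m where "m = card B'"
  have m: "m > 0"
    using B' \<open>w0 \<in> B'\<close> by (auto simp: m_def card_gt_0_iff)
  obtain h where h: "bij_betw h {..<m} B'"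
    using ex_bij_betw_nat_finite[OF B'(1)] by (auto simp: m_def atLeast0LessThan)
  have hB: "h i \<in> B'" if "i < m" for i
    using h that by (auto simp: bij_betw_def)
  obtain \<psi> where \<psi>: "\<And>b. b \<in> B' \<Longrightarrow> bounded_operator t UNIV norm (*) UNIV norm (\<psi> b)"
      "\<And>x. D x = (\<Sum>b\<in>B'. s (\<psi> b x) b)"
    using finite_rank_decomposition[OF B'(1) assms(2) B'(2)] by blast
  have D_sum: "D x = (\<Sum>i<m. s (\<psi> (h i) x) (h i))" for x
    unfolding \<psi>(2) by (rule sum.reindex_bij_betw[OF h, symmetric])
  have "\<forall>i\<in>{..<m}. \<exists>K. \<forall>x. norm (\<psi> (h i) x) \<le> K * norm x"
    using \<psi>(1)[OF hB] by (auto simp: bounded_operator_def)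
  then obtain K where K: "\<And>i x. i < m \<Longrightarrow> norm (\<psi> (h i) x) \<le> K i * norm x"
    by (metis lessThan_iff)
  \<comment> \<open>the absolute values make \<open>R\<close> monotone in the number of summands, whatever the sign of \<open>K i\<close>\<close>
  define R where "R = (\<Sum>i<m. \<bar>K i\<bar> * norm (h i))"
  obtain r0 :: nat where r0: "R / \<epsilon> \<le> real r0"
    using real_arch_simple by blast
  define r where "r = Suc r0"
  have r: "r > 0" "R / real r \<le> \<epsilon>"
  proof -
    have "R \<le> \<epsilon> * real r0"
      using r0 assms(5) by (simp add: field_simps)
    also have "\<dots> \<le> \<epsilon> * real r"
      using assms(5) by (simp add: r_def)
    finally show "R / real r \<le> \<epsilon>"
      by (simp add: r_def field_simps)
  qed (simp add: r_def)
  define f where "f q = h (q mod m)" for q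
  define \<phi> where "\<phi> q x = inverse (of_nat r) * \<psi> (h (q mod m)) x" for q x
  have per: "s (\<phi> (a * m + i) x) (f (a * m + i)) = s (\<phi> i x) (f i)" for a i x
    by (simp add: \<phi>_def f_def)
  have once: "(\<Sum>i<m. s (\<phi> i x) (f i)) = s (inverse (of_nat r)) (D x)" for x
    unfolding D_sum scale_sum_right by (intro sum.cong) (auto simp: \<phi>_def f_def)
  have rounds: "(\<Sum>i<a * m. s (\<phi> i x) (f i)) = s (of_nat a * inverse (of_nat r)) (D x)" for a x
  proof (induction a)
    case (Suc a)
    have "(\<Sum>i<Suc a * m. s (\<phi> i x) (f i)) = (\<Sum>i<a * m + m. s (\<phi> i x) (f i))"
      by (simp add: add.commute)
    also have "\<dots> = s (of_nat a * inverse (of_nat r)) (D x) + s (inverse (of_nat r)) (D x)"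
      unfolding sum_lessThan_add per once Suc ..
    also have "\<dots> = s (of_nat (Suc a) * inverse (of_nat r)) (D x)"
      by (simp add: algebra_simps flip: scale_left_distrib)
    finally show ?case .
  qed simp
  have bound: "norm (\<Sum>i<l. s (\<phi> i x) (f i)) \<le> norm (D x) + \<epsilon> * norm x" if "l \<le> r * m" for l x
  proof -
    define a i where "a = l div m" and "i = l mod m"
    have l: "l = a * m + i" and i: "i < m"
      using m by (auto simp: a_def i_def)
    have a: "a \<le> r"
      using that m unfolding a_def by (metis div_le_mono nonzero_mult_div_cancel_right less_not_refl)
    have "norm (s (of_nat a * inverse (of_nat r)) (D x)) = (real a / real r) * norm (D x)"
      by (simp add: norm_scale norm_mult norm_inverse divide_inverse)
    also have "\<dots> \<le> 1 * norm (D x)"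
      using a r by (intro mult_right_mono) auto
    finally have 1: "norm (s (of_nat a * inverse (of_nat r)) (D x)) \<le> norm (D x)"
      by simp
    have "norm (\<Sum>j<i. s (\<phi> j x) (f j)) \<le> (\<Sum>j<i. inverse (real r) * (\<bar>K j\<bar> * norm (h j)) * norm x)"
    proof (rule sum_norm_le)
      fix j assume "j \<in> {..<i}"
      then have j: "j < m" using i by simp
      have "norm (s (\<phi> j x) (f j)) = inverse (real r) * norm (\<psi> (h j) x) * norm (h j)"
        using j by (simp add: norm_scale \<phi>_def f_def norm_mult norm_inverse)
      also have "\<dots> \<le> inverse (real r) * (\<bar>K j\<bar> * norm x) * norm (h j)"
        by (intro mult_left_mono mult_right_mono order_trans[OF K[OF j]]) auto
      finally show "norm (s (\<phi> j x) (f j)) \<le> inverse (real r) * (\<bar>K j\<bar> * norm (h j)) * norm x"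
        by (simp add: mult_ac)
    qed
    also have "\<dots> = inverse (real r) * (\<Sum>j<i. \<bar>K j\<bar> * norm (h j)) * norm x"
      by (simp add: sum_distrib_left sum_distrib_right)
    also have "\<dots> \<le> inverse (real r) * R * norm x"
      unfolding R_def using i by (intro mult_left_mono mult_right_mono sum_mono2) auto
    also have "\<dots> \<le> \<epsilon> * norm x"
      using r(2) by (intro mult_right_mono) (auto simp: field_simps)
    finally have 2: "norm (\<Sum>j<i. s (\<phi> j x) (f j)) \<le> \<epsilon> * norm x" .
    show ?thesis
      unfolding l sum_lessThan_add per rounds using 1 2 by (rule norm_triangle_mono)
  qed
  show thesis
  proof (rule that[of "r * m" f \<phi>])
    show "0 < r * m" using r m by simp
    show "f i \<noteq> 0" for i
      using hB[of "i mod m"] m by (auto simp: f_def B'_def)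
    show "bounded_operator t UNIV norm (*) UNIV norm (\<phi> i)" for i
    proof -
      have "bounded_operator t UNIV norm (*) UNIV norm (\<psi> (h (i mod m)))"
        using \<psi>(1)[OF hB] m by simp
      then obtain k where k: "\<And>x. norm (\<psi> (h (i mod m)) x) \<le> k * norm x"
        and lin: "\<And>x y. \<psi> (h (i mod m)) (x + y) = \<psi> (h (i mod m)) x + \<psi> (h (i mod m)) y"
          "\<And>c x. \<psi> (h (i mod m)) (t c x) = c * \<psi> (h (i mod m)) x"
        by (auto simp: bounded_operator_def)
      show ?thesis
      proof (rule bounded_operator_UNIV_I)
        show "norm (\<phi> i x) \<le> inverse (real r) * k * norm x" for x
          using mult_left_mono[OF k[of x], of "inverse (real r)"]
          by (simp add: \<phi>_def norm_mult norm_inverse mult.assoc)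
      qed (simp_all add: \<phi>_def lin algebra_simps)
    qed
    show "(\<Sum>i<r * m. s (\<phi> i x) (f i)) = D x" for x
      unfolding rounds using r by simp
  qed (rule bound)
qed

end

section \<open>Concatenating finite blocks into one sequence\<close>

lemma ex_block_position:
  fixes L :: "nat \<Rightarrow> nat"
  assumes "\<And>n. 0 < L n"
  shows "\<exists>n r. r < L n \<and> p = (\<Sum>k<n. L k) + r"
proof (induction p)
  case 0
  then show ?case using assms by (intro exI[of _ 0]) auto
next
  case (Suc p)
  then obtain n r where nr: "r < L n" "p = (\<Sum>k<n. L k) + r" by blast
  show ?case
  proof (cases "Suc r < L n")
    case True
    then show ?thesis using nr by (intro exI[of _ n] exI[of _ "Suc r"]) auto
  next
    case False
    then show ?thesis using nr assms by (intro exI[of _ "Suc n"] exI[of _ 0]) auto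
  qed
qed

lemma block_position_unique:
  fixes L :: "nat \<Rightarrow> nat"
  assumes "r < L n" "r' < L n'" "(\<Sum>k<n. L k) + r = (\<Sum>k<n'. L k) + r'"
  shows "n = n' \<and> r = r'"
proof -
  have *: "\<not> m < m'" if "q < L m" "(\<Sum>k<m. L k) + q = (\<Sum>k<m'. L k) + q'" for m m' q q'
  proof
    assume "m < m'"
    then have "(\<Sum>k<Suc m. L k) \<le> (\<Sum>k<m'. L k)"
      by (intro sum_mono2) auto
    then show False using that by simp
  qed
  have "n = n'"
    using *[OF assms(1,3)] *[OF assms(2) assms(3)[symmetric]] by simp
  then show ?thesis using assms(3) by simp
qed

text \<open>
  Position \<open>p\<close> of the concatenation of blocks of lengths \<open>L 0, L 1, \<dots>\<close> is entry \<open>off p\<close> of block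
  \<open>blk p\<close>.  A partial sum of the concatenated series then splits into complete blocks, whose number
  tends to infinity, and an initial segment of the current one.
\<close>

lemma concatenation:
  fixes L :: "nat \<Rightarrow> nat"
  assumes L: "\<And>n. 0 < L n"
  obtains blk off :: "nat \<Rightarrow> nat" where
    "\<And>p. off p < L (blk p)"
    "filterlim blk at_top sequentially"
    "\<And>(F :: nat \<Rightarrow> nat \<Rightarrow> 'a::comm_monoid_add) p.
       (\<Sum>q<p. F (blk q) (off q)) = (\<Sum>k<blk p. \<Sum>i<L k. F k i) + (\<Sum>i<off p. F (blk p) i)"
proof -
  have "\<exists>pos. \<forall>p. snd (pos p) < L (fst (pos p)) \<and> p = (\<Sum>k<fst (pos p). L k) + snd (pos p)"
    using ex_block_position[of L, OF L] by (intro choice) auto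
  then obtain pos where pos: "\<And>p. snd (pos p) < L (fst (pos p))"
      "\<And>p. p = (\<Sum>k<fst (pos p). L k) + snd (pos p)"
    by blast
  define blk where "blk = fst \<circ> pos"
  define off where "off = snd \<circ> pos"
  have off: "off p < L (blk p)" and start: "p = (\<Sum>k<blk p. L k) + off p" for p
    using pos[of p] by (auto simp: blk_def off_def)
  have at: "blk ((\<Sum>k<n. L k) + r) = n \<and> off ((\<Sum>k<n. L k) + r) = r" if "r < L n" for n r
    using block_position_unique[where L = L, OF off that] start[of "(\<Sum>k<n. L k) + r"] by simp
  have "filterlim blk at_top sequentially"
    unfolding filterlim_at_top
  proof
    fix N
    have "N \<le> blk p" if "(\<Sum>k<N. L k) \<le> p" for p
    proof (rule ccontr)
      assume "\<not> N \<le> blk p"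
      then have "(\<Sum>k<Suc (blk p). L k) \<le> (\<Sum>k<N. L k)"
        by (intro sum_mono2) auto
      then show False
        using that start[of p] off[of p] by simp
    qed
    then show "\<forall>\<^sub>F p in sequentially. N \<le> blk p"
      by (rule eventually_sequentiallyI)
  qed
  moreover have "(\<Sum>q<p. F (blk q) (off q)) = (\<Sum>k<blk p. \<Sum>i<L k. F k i) + (\<Sum>i<off p. F (blk p) i)"
    for F :: "nat \<Rightarrow> nat \<Rightarrow> 'a" and p
  proof -
    have piece: "(\<Sum>i<r. F (blk ((\<Sum>k<n. L k) + i)) (off ((\<Sum>k<n. L k) + i))) = (\<Sum>i<r. F n i)"
      if "r \<le> L n" for n r
      using that by (intro sum.cong) (auto simp: at)
    have full: "(\<Sum>q<(\<Sum>k<n. L k). F (blk q) (off q)) = (\<Sum>k<n. \<Sum>i<L k. F k i)" for n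
      by (induction n) (auto simp: sum_lessThan_add piece)
    have "(\<Sum>q<p. F (blk q) (off q)) = (\<Sum>q<(\<Sum>k<blk p. L k) + off p. F (blk q) (off q))"
      using start[of p] by simp
    also have "\<dots> = (\<Sum>k<blk p. \<Sum>i<L k. F k i) + (\<Sum>i<off p. F (blk p) i)"
      unfolding sum_lessThan_add full using piece[OF less_imp_le[OF off[of p]]] by simp
    finally show ?thesis .
  qed
  ultimately show thesis
    using that off by blast
qed

context scaled_banach
begin

text \<open>
  The expansions of the \<open>D n\<close> are concatenated, the \<open>n\<close>-th one being sliced to accuracy
  \<open>1 / (n + 1)\<close>.  A partial sum of the result is a sum of complete operators \<open>D k\<close> plus a rest within
  one block.  Since \<open>D n x\<close>, the general term of a convergent series, tends to zero, so does the rest.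
\<close>

lemma rank_one_expansion:
  fixes t :: "'k \<Rightarrow> 'x::real_normed_vector \<Rightarrow> 'x"
  assumes D: "\<And>n. bounded_operator t UNIV norm s UNIV norm (D n)"
    and fin: "\<And>n. \<exists>B. finite B \<and> range (D n) \<subseteq> span B"
    and lim: "\<And>x. (\<lambda>n. \<Sum>k<n. D k x) \<longlonglongrightarrow> T x"
    and bdd: "\<And>n x. norm (\<Sum>k<n. D k x) \<le> M * norm x"
    and w0: "(w0 :: 'w) \<noteq> 0"
  obtains w \<phi> K where "\<And>p. w p \<noteq> 0"
    "\<And>p. bounded_operator t UNIV norm (*) UNIV norm (\<phi> p)"
    "\<And>x. (\<lambda>n. \<Sum>p<n. s (\<phi> p x) (w p)) \<longlonglongrightarrow> T x"
    "\<And>n x. norm (\<Sum>p<n. s (\<phi> p x) (w p)) \<le> K * norm x"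
proof -
  define \<epsilon> where "\<epsilon> n = inverse (real (Suc n))" for n
  have \<epsilon>: "0 < \<epsilon> n" "\<epsilon> n \<le> 1" for n
    by (auto simp: \<epsilon>_def inverse_le_1_iff)
  define slicing where "slicing n L f \<phi> \<longleftrightarrow> 0 < L \<and> (\<forall>i. f i \<noteq> 0) \<and>
      (\<forall>i. bounded_operator t UNIV norm (*) UNIV norm (\<phi> i)) \<and>
      (\<forall>x. (\<Sum>i<L. s (\<phi> i x) (f i)) = D n x) \<and>
      (\<forall>x. \<forall>l\<le>L. norm (\<Sum>i<l. s (\<phi> i x) (f i)) \<le> norm (D n x) + \<epsilon> n * norm x)"
    for n and L :: nat and f \<phi>
  have "\<exists>L f \<phi>. slicing n L f \<phi>" for n
  proof -
    obtain B where B: "finite B" "range (D n) \<subseteq> span B" using fin by blast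
    show ?thesis
    proof (rule finite_rank_slicing[OF B(1) D B(2) w0 \<epsilon>(1)[of n]])
      fix L :: nat and f \<phi>
      assume "0 < L" "\<And>i. f i \<noteq> 0"
        "\<And>i. bounded_operator t UNIV norm (*) UNIV norm (\<phi> i)"
        "\<And>x. (\<Sum>i<L. s (\<phi> i x) (f i)) = D n x"
        "\<And>x l. l \<le> L \<Longrightarrow> norm (\<Sum>i<l. s (\<phi> i x) (f i)) \<le> norm (D n x) + \<epsilon> n * norm x"
      then show ?thesis
        unfolding slicing_def by (intro exI[of _ L] exI[of _ f] exI[of _ \<phi>] conjI allI impI)
    qed
  qed
  then obtain L f \<phi> where "\<And>n. slicing n (L n) (f n) (\<phi> n)"
    by metis
  then have L: "\<And>n. 0 < L n" and f: "\<And>n i. f n i \<noteq> 0"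
    and \<phi>: "\<And>n i. bounded_operator t UNIV norm (*) UNIV norm (\<phi> n i)"
    and block: "\<And>n x. (\<Sum>i<L n. s (\<phi> n i x) (f n i)) = D n x"
    and part: "\<And>n x l. l \<le> L n \<Longrightarrow> norm (\<Sum>i<l. s (\<phi> n i x) (f n i)) \<le> norm (D n x) + \<epsilon> n * norm x"
    by (simp_all add: slicing_def)
  obtain blk off where off: "\<And>p. off p < L (blk p)"
    and blk: "filterlim blk at_top sequentially"
    and sum: "\<And>(F :: nat \<Rightarrow> nat \<Rightarrow> 'w) p.
       (\<Sum>q<p. F (blk q) (off q)) = (\<Sum>k<blk p. \<Sum>i<L k. F k i) + (\<Sum>i<off p. F (blk p) i)"
    by (rule concatenation[where ?'a = 'w, OF L]) (rule that)
  define rest where "rest p x = (\<Sum>i<off p. s (\<phi> (blk p) i x) (f (blk p) i))" for p x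
  have psum: "(\<Sum>q<p. s (\<phi> (blk q) (off q) x) (f (blk q) (off q))) = (\<Sum>k<blk p. D k x) + rest p x" for p x
    using sum[where F = "\<lambda>n i. s (\<phi> n i x) (f n i)"] by (simp add: block rest_def)
  have rest: "norm (rest p x) \<le> norm (D (blk p) x) + \<epsilon> (blk p) * norm x" for p x
    unfolding rest_def by (rule part[OF less_imp_le[OF off]])
  have Dn: "norm (D n x) \<le> 2 * M * norm x" for n x
  proof -
    have "norm (D n x) = norm ((\<Sum>k<Suc n. D k x) - (\<Sum>k<n. D k x))" by simp
    also have "\<dots> \<le> M * norm x + M * norm x"
      by (intro norm_triangle_le_diff add_mono bdd)
    finally show ?thesis by simp
  qed
  show thesis
  proof (rule that[of "\<lambda>p. f (blk p) (off p)" "\<lambda>p. \<phi> (blk p) (off p)" "3 * M + 1"])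
    show "f (blk p) (off p) \<noteq> 0" for p by (rule f)
    show "bounded_operator t UNIV norm (*) UNIV norm (\<phi> (blk p) (off p))" for p by (rule \<phi>)
    fix x
    have "(\<lambda>n. D n x) sums T x"
      using lim[of x] by (simp add: sums_def)
    then have "(\<lambda>n. norm (D n x)) \<longlonglongrightarrow> 0"
      by (intro tendsto_norm_zero summable_LIMSEQ_zero sums_summable)
    moreover have "(\<lambda>n. \<epsilon> n * norm x) \<longlonglongrightarrow> 0"
      unfolding \<epsilon>_def by (intro tendsto_mult_left_zero LIMSEQ_inverse_real_of_nat)
    ultimately have "(\<lambda>n. norm (D n x) + \<epsilon> n * norm x) \<longlonglongrightarrow> 0"
      using tendsto_add by fastforce
    from filterlim_compose[OF this blk]
    have "(\<lambda>p. rest p x) \<longlonglongrightarrow> 0"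
      by (rule Lim_null_comparison[rotated]) (use rest in auto)
    from tendsto_add[OF filterlim_compose[OF lim blk] this]
    show "(\<lambda>n. \<Sum>q<n. s (\<phi> (blk q) (off q) x) (f (blk q) (off q))) \<longlonglongrightarrow> T x"
      by (simp add: psum)
    fix p
    have "\<epsilon> (blk p) * norm x \<le> 1 * norm x"
      by (intro mult_right_mono \<epsilon>) auto
    then have "norm (rest p x) \<le> 2 * M * norm x + norm x"
      using rest[of p x] Dn[of "blk p" x] by linarith
    then have "norm ((\<Sum>k<blk p. D k x) + rest p x) \<le> M * norm x + (2 * M * norm x + norm x)"
      by (intro norm_triangle_mono bdd)
    then show "norm (\<Sum>q<p. s (\<phi> (blk q) (off q) x) (f (blk q) (off q))) \<le> (3 * M + 1) * norm x"
      by (simp add: psum algebra_simps)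
  qed
qed

end

section \<open>The space of coefficients of convergent series\<close>

lemma sum_fun_apply: "(\<Sum>i\<in>A. f i) x = (\<Sum>i\<in>A. f i x)"
  by (induction A rule: infinite_finite_induct) auto

lemma vector_space_seq_scale: "vector_space (seq_scale :: 'k::field \<Rightarrow> _)"
  by unfold_locales (auto simp: seq_scale_def algebra_simps)

locale series_space = scaled_banach s
  for s :: "'k::{real_normed_field,banach} \<Rightarrow> 'w::banach \<Rightarrow> 'w" +
  fixes w :: "nat \<Rightarrow> 'w"
  assumes w_nonzero: "w n \<noteq> 0"
begin

definition psum :: "(nat \<Rightarrow> 'k) \<Rightarrow> nat \<Rightarrow> 'w" where
  "psum a n = (\<Sum>i<n. s (a i) (w i))"

definition coeff_space :: "(nat \<Rightarrow> 'k) set" where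
  "coeff_space = {a. convergent (psum a)}"

text \<open>
  A function that is to be used as a metric on a carrier set must be nonnegative everywhere, hence
  the default value \<open>0\<close> for divergent series, whose supremum is unspecified if unbounded.
\<close>

definition nrm :: "(nat \<Rightarrow> 'k) \<Rightarrow> real" where
  "nrm a = (if a \<in> coeff_space then SUP n. norm (psum a n) else 0)"

definition unit_seq :: "nat \<Rightarrow> nat \<Rightarrow> 'k" where
  "unit_seq n = (\<lambda>i. if i = n then 1 else 0)"

lemma psum_add: "psum (a + b) n = psum a n + psum b n"
  by (simp add: psum_def scale_left_distrib sum.distrib)

lemma psum_diff: "psum (a - b) n = psum a n - psum b n"
  by (simp add: psum_def scale_left_diff_distrib sum_subtractf)

lemma psum_scale: "psum (seq_scale c a) n = s c (psum a n)"
  by (simp add: psum_def seq_scale_def scale_sum_right)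

lemma psum_0: "psum 0 n = 0"
  by (simp add: psum_def)

lemma psum_Suc: "psum a (Suc n) = psum a n + s (a n) (w n)"
  by (simp add: psum_def)

lemma subspace_coeff_space: "module.subspace seq_scale coeff_space"
proof -
  interpret vs: vector_space "seq_scale :: 'k \<Rightarrow> _" by (rule vector_space_seq_scale)
  show ?thesis
  proof (rule vs.subspaceI)
    show "0 \<in> coeff_space"
      by (simp add: coeff_space_def psum_def[abs_def] convergent_const)
  next
    fix a b assume "a \<in> coeff_space" "b \<in> coeff_space"
    then have "convergent (\<lambda>n. psum a n + psum b n)"
      by (intro convergent_add) (auto simp: coeff_space_def)
    then show "a + b \<in> coeff_space"
      by (simp add: coeff_space_def flip: psum_add)
  next
    fix c a assume "a \<in> coeff_space"
    then obtain l where "psum a \<longlonglongrightarrow> l"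
      by (auto simp: coeff_space_def convergent_def)
    then have "(\<lambda>n. psum (seq_scale c a) n) \<longlonglongrightarrow> s c l"
      unfolding psum_scale by (rule tendsto_scale_right)
    then show "seq_scale c a \<in> coeff_space"
      by (auto simp: coeff_space_def convergent_def)
  qed
qed

lemma coeff_space_diff: "a \<in> coeff_space \<Longrightarrow> b \<in> coeff_space \<Longrightarrow> a - b \<in> coeff_space"
  using module.subspace_diff[OF _ subspace_coeff_space] vector_space_seq_scale
  by (metis module_iff_vector_space)

lemma bdd_psum: "a \<in> coeff_space \<Longrightarrow> bdd_above (range (\<lambda>n. norm (psum a n)))"
  using convergent_imp_Bseq[of "psum a"] by (auto simp: coeff_space_def Bseq_def intro: bdd_aboveI2)

lemma psum_le_nrm: "a \<in> coeff_space \<Longrightarrow> norm (psum a n) \<le> nrm a"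
  by (auto simp: nrm_def intro: cSUP_upper bdd_psum)

lemma nrm_le: "(\<And>n. norm (psum a n) \<le> r) \<Longrightarrow> nrm a \<le> r"
  by (auto simp: nrm_def intro: cSUP_least order_trans[OF norm_ge_zero])

lemma nrm_nonneg: "0 \<le> nrm a"
  using psum_le_nrm[of a 0] by (cases "a \<in> coeff_space") (simp_all add: psum_def nrm_def)

text \<open>
  A term of a series is the difference of two successive partial sums.  As \<open>w n \<noteq> 0\<close>, this makes
  the coordinate functionals of the space continuous; it is what separates points and makes
  expansions in the unit sequences unique.
\<close>

lemma coeff_le_nrm:
  assumes "a \<in> coeff_space"
  shows "norm (a n) \<le> 2 * nrm a / norm (w n)"
proof -
  have "s (a n) (w n) = psum a (Suc n) - psum a n"
    by (simp add: psum_Suc)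
  then have "norm (a n) * norm (w n) = norm (psum a (Suc n) - psum a n)"
    by (metis norm_scale)
  also have "\<dots> \<le> nrm a + nrm a"
    by (intro norm_triangle_le_diff add_mono psum_le_nrm assms)
  finally show ?thesis
    using w_nonzero by (simp add: field_simps)
qed

lemma normed_space: "normed_space_on seq_scale coeff_space nrm"
  unfolding normed_space_on_def
proof (intro conjI ballI allI)
  fix a assume a: "a \<in> coeff_space"
  show "nrm a = 0 \<longleftrightarrow> a = 0"
  proof
    assume "nrm a = 0"
    then show "a = 0"
      using coeff_le_nrm[OF a] by (auto simp: fun_eq_iff)
  qed (simp add: nrm_def psum_0)
next
  fix c a assume a: "a \<in> coeff_space"
  show "nrm (seq_scale c a) = norm c * nrm a"
  proof (cases "c = 0")
    case True
    then show ?thesis by (simp add: nrm_def psum_scale)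
  next
    case False
    have c: "seq_scale c a \<in> coeff_space"
      using subspace_coeff_space a vector_space_seq_scale
      by (metis module.subspace_scale module_iff_vector_space)
    have "norm c * norm (psum a n) \<le> nrm (seq_scale c a)" for n
      using psum_le_nrm[OF c, of n] by (simp add: psum_scale norm_scale)
    then have "nrm a \<le> nrm (seq_scale c a) / norm c"
      using False by (intro nrm_le) (simp add: field_simps)
    moreover have "nrm (seq_scale c a) \<le> norm c * nrm a"
      by (intro nrm_le) (simp add: psum_scale norm_scale mult_left_mono psum_le_nrm a)
    ultimately show ?thesis
      using False by (simp add: field_simps)
  qed
next
  fix a b assume "a \<in> coeff_space" "b \<in> coeff_space"
  then show "nrm (a + b) \<le> nrm a + nrm b"
    by (intro nrm_le) (simp add: psum_add norm_triangle_mono psum_le_nrm)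
qed (use vector_space_seq_scale subspace_coeff_space nrm_nonneg in auto)

lemma nrm_diff_commute: "nrm (a - b) = nrm (b - a)"
proof -
  have "a - b \<in> coeff_space \<longleftrightarrow> b - a \<in> coeff_space"
    using coeff_space_diff[of 0 "a - b"] coeff_space_diff[of 0 "b - a"] module.subspace_0[OF _ subspace_coeff_space]
      vector_space_seq_scale by (auto simp: module_iff_vector_space)
  then show ?thesis
    by (simp add: nrm_def psum_diff norm_minus_commute)
qed

text \<open>
  By \<open>coeff_le_nrm\<close> a Cauchy sequence converges in each coordinate.  The coordinatewise limit \<open>g\<close>
  is the limit in norm because the partial sums converge uniformly in their length, and this
  uniformity also gives convergence of the series with coefficients \<open>g\<close>.
\<close>

lemma mcomplete_coeff_space: "Metric_space.mcomplete coeff_space (\<lambda>a b. nrm (a - b))"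
proof -
  interpret Metric_space coeff_space "\<lambda>a b. nrm (a - b)"
  proof
    fix a b c assume abc: "a \<in> coeff_space" "b \<in> coeff_space" "c \<in> coeff_space"
    show "nrm (a - b) = 0 \<longleftrightarrow> a = b"
      using normed_space coeff_space_diff[OF abc(1,2)] by (auto simp: normed_space_on_def)
    have "nrm ((a - b) + (b - c)) \<le> nrm (a - b) + nrm (b - c)"
      using normed_space coeff_space_diff[OF abc(1,2)] coeff_space_diff[OF abc(2,3)]
      by (simp only: normed_space_on_def)
    then show "nrm (a - c) \<le> nrm (a - b) + nrm (b - c)"
      by simp
  qed (auto intro: nrm_nonneg nrm_diff_commute)
  show ?thesis
    unfolding mcomplete_def
  proof (intro allI impI)
    fix f assume f: "MCauchy f"
    have fc: "f k \<in> coeff_space" for k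
      using f by (auto simp: MCauchy_def)
    have fC: "\<exists>N. \<forall>k\<ge>N. \<forall>l\<ge>N. nrm (f k - f l) < e" if "e > 0" for e
      using f that by (auto simp: MCauchy_def)
    have "Cauchy (\<lambda>k. f k i)" for i
      unfolding Cauchy_def dist_norm
    proof (intro allI impI)
      fix e :: real assume "e > 0"
      then have "e * norm (w i) / 2 > 0"
        using w_nonzero by simp
      from fC[OF this] obtain N where N: "\<And>k l. k \<ge> N \<Longrightarrow> l \<ge> N \<Longrightarrow> nrm (f k - f l) < e * norm (w i) / 2"
        by blast
      have "norm (f k i - f l i) < e" if "k \<ge> N" "l \<ge> N" for k l
      proof -
        have "2 * nrm (f k - f l) / norm (w i) < e"
          using N[OF that] w_nonzero[of i] by (simp add: pos_divide_less_eq)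
        then show ?thesis
          using coeff_le_nrm[OF coeff_space_diff[OF fc fc], of k l i] by simp
      qed
      then show "\<exists>N. \<forall>k\<ge>N. \<forall>l\<ge>N. norm (f k i - f l i) < e"
        by blast
    qed
    then have "\<exists>g. \<forall>i. (\<lambda>k. f k i) \<longlonglongrightarrow> g i"
      by (intro choice allI) (simp add: Cauchy_convergent_iff convergent_def)
    then obtain g where g: "\<And>i. (\<lambda>k. f k i) \<longlonglongrightarrow> g i"
      by blast
    have psum_lim: "(\<lambda>k. psum (f k) n) \<longlonglongrightarrow> psum g n" for n
      unfolding psum_def by (intro tendsto_sum tendsto_scale_left g)
    \<comment> \<open>the Cauchy estimate passes to the limit one partial sum at a time, uniformly in the length\<close>
    have unif: "\<exists>N. \<forall>k\<ge>N. \<forall>n. norm (psum (f k) n - psum g n) \<le> e" if "e > 0" for e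
    proof -
      obtain N where N: "\<And>k l. k \<ge> N \<Longrightarrow> l \<ge> N \<Longrightarrow> nrm (f k - f l) < e"
        using fC[OF \<open>e > 0\<close>] by blast
      have "norm (psum (f k) n - psum g n) \<le> e" if k: "k \<ge> N" for k n
      proof (rule Lim_bounded)
        show "(\<lambda>l. norm (psum (f k) n - psum (f l) n)) \<longlonglongrightarrow> norm (psum (f k) n - psum g n)"
          by (intro tendsto_intros psum_lim)
        show "\<forall>l\<ge>N. norm (psum (f k) n - psum (f l) n) \<le> e"
          unfolding psum_diff[symmetric]
          by (intro allI impI order_trans[OF psum_le_nrm[OF coeff_space_diff[OF fc fc]] less_imp_le[OF N[OF k]]])
      qed
      then show ?thesis by blast
    qed
    have "Cauchy (psum g)"
      unfolding Cauchy_def dist_norm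
    proof (intro allI impI)
      fix e :: real assume "e > 0"
      then obtain k where k: "\<And>n. norm (psum (f k) n - psum g n) \<le> e / 4"
        using unif[of "e / 4"] by auto
      have "Cauchy (psum (f k))"
        using fc[of k] by (simp add: coeff_space_def Cauchy_convergent_iff)
      then obtain M where M: "\<And>m n. m \<ge> M \<Longrightarrow> n \<ge> M \<Longrightarrow> norm (psum (f k) m - psum (f k) n) < e / 4"
        using \<open>e > 0\<close> unfolding Cauchy_def dist_norm by (meson divide_pos_pos zero_less_numeral)
      have "norm (psum g m - psum g n) < e" if "m \<ge> M" "n \<ge> M" for m n
      proof -
        have "norm (psum g m - psum g n)
            = norm ((psum (f k) m - psum (f k) n) - (psum (f k) m - psum g m) + (psum (f k) n - psum g n))"
          by simp
        also have "\<dots> \<le> norm (psum (f k) m - psum (f k) n) + norm (psum (f k) m - psum g m)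
            + norm (psum (f k) n - psum g n)"
          by (rule order_trans[OF norm_triangle_ineq add_right_mono[OF norm_triangle_ineq4]])
        also have "\<dots> < e"
          using M[OF that] k[of m] k[of n] \<open>e > 0\<close> by linarith
        finally show ?thesis .
      qed
      then show "\<exists>M. \<forall>m\<ge>M. \<forall>n\<ge>M. norm (psum g m - psum g n) < e"
        by blast
    qed
    then have gc: "g \<in> coeff_space"
      by (simp add: coeff_space_def Cauchy_convergent_iff)
    have "limitin mtopology f g sequentially"
      unfolding limitin_metric
    proof (intro conjI allI impI gc)
      fix e :: real assume "e > 0"
      then obtain N where N: "\<And>k n. k \<ge> N \<Longrightarrow> norm (psum (f k) n - psum g n) \<le> e / 2"
        using unif[of "e / 2"] by auto
      have "nrm (f k - g) \<le> e / 2" if "k \<ge> N" for k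
        using N[OF that] by (intro nrm_le) (simp add: psum_diff)
      then show "\<forall>\<^sub>F k in sequentially. f k \<in> coeff_space \<and> nrm (f k - g) < e"
        using fc \<open>e > 0\<close> by (intro eventually_sequentiallyI[of N]) fastforce
    qed
    then show "\<exists>g. limitin mtopology f g sequentially"
      by blast
  qed
qed

lemma banach_space: "banach_space_on seq_scale coeff_space nrm"
  using normed_space mcomplete_coeff_space by (simp add: banach_space_on_def)

lemma psum_unit_seq: "psum (unit_seq i) n = (if i < n then w i else 0)"
proof -
  have "psum (unit_seq i) n = (\<Sum>k<n. if k = i then w i else 0)"
    unfolding psum_def unit_seq_def by (intro sum.cong) auto
  then show ?thesis by simp
qed

lemma unit_seq_coeff_space: "unit_seq i \<in> coeff_space"
proof -
  have "\<forall>\<^sub>F n in sequentially. psum (unit_seq i) n = w i"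
    by (intro eventually_sequentiallyI[of "Suc i"]) (simp add: psum_unit_seq)
  then show ?thesis
    by (auto simp: coeff_space_def convergent_def intro: tendsto_eventually)
qed

lemma truncation_apply:
  "(\<Sum>i<n. seq_scale (b i) (unit_seq i)) k = (if k < n then b k else 0)"
proof -
  have "(\<Sum>i<n. seq_scale (b i) (unit_seq i)) k = (\<Sum>i<n. if i = k then b k else 0)"
    unfolding sum_fun_apply by (intro sum.cong) (auto simp: seq_scale_def unit_seq_def)
  then show ?thesis by simp
qed

lemma truncation_coeff_space: "(\<Sum>i<n. seq_scale (b i) (unit_seq i)) \<in> coeff_space"
proof -
  interpret vs: vector_space "seq_scale :: 'k \<Rightarrow> _" by (rule vector_space_seq_scale)
  show ?thesis
    by (intro vs.subspace_sum vs.subspace_scale subspace_coeff_space unit_seq_coeff_space)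
qed

text \<open>
  Truncating the coefficients after \<open>n\<close> terms freezes the partial sums from \<open>n\<close> on.  So the norm of
  the \<open>n\<close>-th remainder of \<open>b \<in> coeff_space\<close> is the supremum of \<open>norm (psum b m - psum b n)\<close> over
  \<open>m \<ge> n\<close>, which is small for large \<open>n\<close> by the Cauchy criterion.
\<close>

lemma psum_truncation:
  "psum (\<Sum>i<n. seq_scale (b i) (unit_seq i)) m = psum b (min m n)"
proof -
  have "psum (\<Sum>i<n. seq_scale (b i) (unit_seq i)) m = (\<Sum>k<m. if k < n then s (b k) (w k) else 0)"
    unfolding psum_def truncation_apply by (intro sum.cong) auto
  also have "\<dots> = psum b (min m n)"
    unfolding psum_def by (rule sum.mono_neutral_cong_right) auto
  finally show ?thesis .
qed

lemma schauder_basis_unit_seq: "schauder_basis seq_scale coeff_space nrm unit_seq"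
  unfolding schauder_basis_def
proof (intro conjI allI ballI)
  fix a assume a: "a \<in> coeff_space"
  let ?tr = "\<lambda>b n. \<Sum>i<n. seq_scale (b i) (unit_seq i)"
  have "(\<lambda>n. nrm (a - ?tr a n)) \<longlonglongrightarrow> 0"
  proof (rule LIMSEQ_I)
    fix e :: real assume "e > 0"
    have "Cauchy (psum a)"
      using a by (simp add: coeff_space_def Cauchy_convergent_iff)
    then obtain N where N: "\<And>m n. m \<ge> N \<Longrightarrow> n \<ge> N \<Longrightarrow> norm (psum a m - psum a n) < e / 2"
      using \<open>e > 0\<close> unfolding Cauchy_def dist_norm by (meson half_gt_zero)
    have "nrm (a - ?tr a n) \<le> e / 2" if "n \<ge> N" for n
    proof (rule nrm_le)
      fix m
      show "norm (psum (a - ?tr a n) m) \<le> e / 2"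
        using N[of m n] that \<open>e > 0\<close>
        by (cases "m \<le> n") (auto simp: psum_diff psum_truncation min_def)
    qed
    then show "\<exists>N. \<forall>n\<ge>N. norm (nrm (a - ?tr a n) - 0) < e"
      using nrm_nonneg \<open>e > 0\<close> by (intro exI[of _ N]) fastforce
  qed
  moreover have "b = a" if lim: "(\<lambda>n. nrm (a - ?tr b n)) \<longlonglongrightarrow> 0" for b
  proof
    fix k
    have "norm (a k - b k) \<le> 2 * nrm (a - ?tr b n) / norm (w k)" if "n \<ge> Suc k" for n
      using coeff_le_nrm[OF coeff_space_diff[OF a truncation_coeff_space[of b n]], of k] that
      by (simp add: truncation_apply)
    moreover have "(\<lambda>n. 2 * nrm (a - ?tr b n) / norm (w k)) \<longlonglongrightarrow> 2 * 0 / norm (w k)"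
      by (intro tendsto_intros lim) (use w_nonzero in auto)
    ultimately have "norm (a k - b k) \<le> 2 * 0 / norm (w k)"
      by (intro Lim_bounded2) auto
    then show "b k = a k" by simp
  qed
  ultimately show "\<exists>!b. (\<lambda>n. nrm (a - ?tr b n)) \<longlonglongrightarrow> 0"
    by (intro ex1I[of _ a])
qed (rule unit_seq_coeff_space)

text \<open>
  The summation operator is bounded because the norm of a limit is at most the supremum of the
  norms of the partial sums.
\<close>

lemma bounded_operator_suminf:
  "bounded_operator seq_scale coeff_space nrm s UNIV norm (\<lambda>a. lim (psum a))"
proof -
  have lim: "psum a \<longlonglongrightarrow> lim (psum a)" if "a \<in> coeff_space" for a
    using that by (simp add: coeff_space_def convergent_LIMSEQ_iff)
  have add: "lim (psum (a + b)) = lim (psum a) + lim (psum b)" if "a \<in> coeff_space" "b \<in> coeff_space" for a b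
    using tendsto_add[OF lim[OF that(1)] lim[OF that(2)]] by (intro limI) (simp add: psum_add[abs_def])
  have scale: "lim (psum (seq_scale c a)) = s c (lim (psum a))" if "a \<in> coeff_space" for a c
    using tendsto_scale_right[OF lim[OF that]] by (intro limI) (simp add: psum_scale[abs_def])
  have bound: "norm (lim (psum a)) \<le> 1 * nrm a" if "a \<in> coeff_space" for a
    using psum_le_nrm[OF that] by (intro Lim_bounded[OF tendsto_norm[OF lim[OF that]], of 0]) simp
  then show ?thesis
    unfolding bounded_operator_def
    by (intro conjI ballI allI exI[of _ 1]) (simp_all only: add scale bound UNIV_I)
qed

text \<open>
  Convergence of the expansion puts the sequence of the \<open>\<phi> p x\<close> into the coefficient space, and
  the bound on the partial sums is the bound \<open>K * norm x\<close> for its norm there.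
\<close>

lemma factorization:
  fixes t :: "'k \<Rightarrow> 'x::real_normed_vector \<Rightarrow> 'x"
  assumes \<phi>: "\<And>p. bounded_operator t UNIV norm (*) UNIV norm (\<phi> p)"
    and lim: "\<And>x. (\<lambda>n. \<Sum>p<n. s (\<phi> p x) (w p)) \<longlonglongrightarrow> T x"
    and bound: "\<And>n x. norm (\<Sum>p<n. s (\<phi> p x) (w p)) \<le> K * norm x"
  shows "bounded_operator t UNIV norm seq_scale coeff_space nrm (\<lambda>x p. \<phi> p x)"
    and "T = (\<lambda>a. lim (psum a)) \<circ> (\<lambda>x p. \<phi> p x)"
proof -
  have psum: "psum (\<lambda>p. \<phi> p x) = (\<lambda>n. \<Sum>p<n. s (\<phi> p x) (w p))" for x
    by (simp add: psum_def fun_eq_iff)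
  have lim': "psum (\<lambda>p. \<phi> p x) \<longlonglongrightarrow> T x" for x
    unfolding psum by (rule lim)
  show "bounded_operator t UNIV norm seq_scale coeff_space nrm (\<lambda>x p. \<phi> p x)"
    unfolding bounded_operator_def
  proof (intro conjI ballI allI exI)
    show "(\<lambda>p. \<phi> p x) \<in> coeff_space" for x
      using lim'[of x] by (auto simp: coeff_space_def convergent_def)
    show "(\<lambda>p. \<phi> p (x + y)) = (\<lambda>p. \<phi> p x) + (\<lambda>p. \<phi> p y)" for x y
      using \<phi> by (simp add: bounded_operator_def fun_eq_iff)
    show "(\<lambda>p. \<phi> p (t c x)) = seq_scale c (\<lambda>p. \<phi> p x)" for c x
      using \<phi> by (simp add: bounded_operator_def seq_scale_def fun_eq_iff)
    show "nrm (\<lambda>p. \<phi> p x) \<le> K * norm x" for x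
      by (rule nrm_le) (simp add: psum bound)
  qed
  show "T = (\<lambda>a. lim (psum a)) \<circ> (\<lambda>x p. \<phi> p x)"
    using limI[OF lim'] by (simp add: fun_eq_iff)
qed

end

section \<open>Factorization through a space with a basis\<close>

theorem theorem2p1:
  fixes sX :: "'k::{real_normed_field,banach} \<Rightarrow> 'x::banach \<Rightarrow> 'x"
    and sW :: "'k \<Rightarrow> 'w::banach \<Rightarrow> 'w"
    and T :: "'x \<Rightarrow> 'w"
    and S :: "nat \<Rightarrow> 'x \<Rightarrow> 'w"
    and C :: real
  assumes "banach_space_on sX UNIV norm"
    and "banach_space_on sW UNIV norm"
    and "bounded_operator sX UNIV norm sW UNIV norm T"
    and "C \<ge> 1"
    and "\<And>N. N \<ge> 1 \<Longrightarrow> finite_rank_operator sX UNIV norm sW UNIV norm (S N)"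
    and "\<And>x. (\<lambda>N. S N x) \<longlonglongrightarrow> T x"
    and "\<And>N. N \<ge> 1 \<Longrightarrow> onorm (S N) \<le> C * onorm T"
  shows "\<exists>(Y :: (nat \<Rightarrow> 'k) set) nY e A j.
           banach_space_on seq_scale Y nY \<and>
           schauder_basis seq_scale Y nY e \<and>
           bounded_operator sX UNIV norm seq_scale Y nY A \<and>
           bounded_operator seq_scale Y nY sW UNIV norm j \<and>
           T = j \<circ> A"
proof -
  interpret W: scaled_banach sW
    using assms(2)
    by (simp add: banach_space_on_def normed_space_on_def scaled_banach_def scaled_banach_axioms_def)
  show ?thesis
  proof (cases "\<exists>w0 :: 'w. w0 \<noteq> 0")
    case True
    then obtain w0 :: 'w where w0: "w0 \<noteq> 0"
      by blast
    define M where "M = \<bar>C * onorm T\<bar>"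
    have S: "bounded_operator sX UNIV norm sW UNIV norm (S N)"
      and S_range: "\<exists>B. finite B \<and> range (S N) = W.span B" if "N \<ge> 1" for N
      using assms(5)[OF that] by (simp_all add: finite_rank_operator_def)
    have S_bound: "norm (S N x) \<le> M * norm x" if "N \<ge> 1" for N x
    proof -
      have "norm (S N x) \<le> onorm (S N) * norm x"
        by (rule norm_le_onorm_mult[OF S[OF that]])
      also have "\<dots> \<le> M * norm x"
        unfolding M_def by (intro mult_right_mono order_trans[OF assms(7)[OF that]]) auto
      finally show ?thesis .
    qed
    \<comment> \<open>\<open>S 0\<close> is arbitrary, so the telescoping differences start from the zero operator instead\<close>
    define S' where "S' n = (if n = 0 then (\<lambda>x. 0) else S n)" for n
    have S': "S' n (x + y) = S' n x + S' n y" "S' n (sX c x) = sW c (S' n x)"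
        "norm (S' n x) \<le> M * norm x" for n x y c
      using S[of n] S_bound[of n x] by (auto simp: S'_def bounded_operator_def M_def)
    have S'_range: "\<exists>B. finite B \<and> range (S' n) \<subseteq> W.span B" for n
      using S_range[of n] by (cases "n = 0") (auto simp: S'_def intro: exI[of _ "{}"])
    define D where "D n x = S' (Suc n) x - S' n x" for n x
    have D_sum: "(\<Sum>k<n. D k x) = S' n x" for n x
    proof (induction n)
      case 0
      then show ?case by (simp add: S'_def)
    next
      case (Suc n)
      then show ?case by (simp add: D_def)
    qed
    show ?thesis
    proof (rule W.rank_one_expansion[of sX D T M w0])
      show "bounded_operator sX UNIV norm sW UNIV norm (D n)" for n
      proof (rule bounded_operator_UNIV_I)
        have "norm (D n x) \<le> M * norm x + M * norm x" for x
          unfolding D_def by (intro norm_triangle_le_diff add_mono S')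
        then show "norm (D n x) \<le> (M + M) * norm x" for x
          by (simp add: algebra_simps)
      qed (simp_all add: D_def S' W.scale_right_diff_distrib)
      show "\<exists>B. finite B \<and> range (D n) \<subseteq> W.span B" for n
      proof -
        obtain B B' where B: "finite B" "range (S' (Suc n)) \<subseteq> W.span B"
          and B': "finite B'" "range (S' n) \<subseteq> W.span B'"
          using S'_range by meson
        have "D n x \<in> W.span (B \<union> B')" for x
          unfolding D_def
          using B(2) B'(2) W.span_mono[of B "B \<union> B'"] W.span_mono[of B' "B \<union> B'"]
          by (intro W.span_diff) auto
        then show ?thesis
          using B(1) B'(1) by (intro exI[of _ "B \<union> B'"]) auto
      qed
      show "(\<lambda>n. \<Sum>k<n. D k x) \<longlonglongrightarrow> T x" for x
      proof (rule Lim_transform_eventually[OF assms(6)])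
        show "\<forall>\<^sub>F n in sequentially. S n x = (\<Sum>k<n. D k x)"
          unfolding D_sum by (rule eventually_sequentiallyI[of 1]) (simp add: S'_def)
      qed
      show "norm (\<Sum>k<n. D k x) \<le> M * norm x" for n x
        unfolding D_sum by (rule S')
    next
      fix w :: "nat \<Rightarrow> 'w" and \<phi> K
      assume w: "\<And>p. w p \<noteq> 0"
        and \<phi>: "\<And>p. bounded_operator sX UNIV norm (*) UNIV norm (\<phi> p)"
          "\<And>x. (\<lambda>n. \<Sum>p<n. sW (\<phi> p x) (w p)) \<longlonglongrightarrow> T x"
          "\<And>n x. norm (\<Sum>p<n. sW (\<phi> p x) (w p)) \<le> K * norm x"
      interpret Y: series_space sW w
        by unfold_locales (rule w)
      show ?thesis
        using Y.banach_space Y.schauder_basis_unit_seq Y.factorization[OF \<phi>] Y.bounded_operator_suminf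
        by (intro exI conjI)
    qed (rule w0)
  next
    case False
    then have W0: "v = 0" for v :: 'w
      by blast
    \<comment> \<open>no nonzero vectors are available, so any space with a basis serves: sum scalars instead\<close>
    interpret Y: series_space "(*) :: 'k \<Rightarrow> 'k \<Rightarrow> 'k" "\<lambda>_. 1"
      by unfold_locales (auto simp: algebra_simps norm_mult)
    have "bounded_operator sX UNIV norm seq_scale Y.coeff_space Y.nrm (\<lambda>x p. 0)"
      by (rule Y.factorization(1)[where K = 0 and T = "\<lambda>x. 0"])
        (auto intro!: bounded_operator_UNIV_I[where K = 0])
    moreover have "bounded_operator seq_scale Y.coeff_space Y.nrm sW UNIV norm (\<lambda>a. 0)"
      unfolding bounded_operator_def by (intro conjI ballI allI exI[of _ 0]) auto
    moreover have "T = (\<lambda>a. 0) \<circ> (\<lambda>x p. 0 :: 'k)"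
      using W0 by (simp add: fun_eq_iff)
    ultimately show ?thesis
      using Y.banach_space Y.schauder_basis_unit_seq by (intro exI conjI)
  qed
qed

end
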